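(* Let $a,b\in\mathbb{R}$ with $a<b$ and $m,n\in\mathbb{N}=\{1,2,\dots\}$ with $m\le n-1$. Then for all $X,Y\in\mathcal{X}_{[a,b]}$: if $X$ dominates $Y$ in $(n,m)\mathrm{SD}_{[a,b]}$, then $X$ dominates $Y$ in $(n,m)\mathrm{SD}_{\mathbb{R}}$. Moreover, the backward implication (namely, that for all $X,Y\in\mathcal{X}_{[a,b]}$, if $X$ dominates $Y$ in $(n,m)\mathrm{SD}_{\mathbb{R}}$ then $X$ dominates $Y$ in $(n,m)\mathrm{SD}_{[a,b]}$) holds if and only if $n-m\le 3$.
   Context: $\mathcal{X}_{[a,b]}$ denotes the set of all bounded random variables taking values in $[a,b]$, and $\mathcal{X}$ the set of all bounded real random variables. All relations below depend only on the distributions, and every distribution supported in $[a,b]$ is the distribution of some element of $\mathcal{X}_{[a,b]}$. $F_X$ is the distribution function of $X$. Write $[n]=\{1,\dots,n\}$. For a distribution function $F$, put $F^{[1]}=F$ and $F^{[k]}(\eta)=\int_{-\infty}^{\eta}F^{[k-1]}(\xi)\,\mathrm{d}\xi$ for $\eta\in\mathbb{R}$, $k\ge 2$. (Thus $F_X^{[k+1]}(\eta)=\frac{1}{k!}\mathbb{E}[(\eta-X)_+^{k}]$ for $k\ge1$, where $x_+=\max\{0,x\}$.) For $X,Y\in\mathcal{X}$, $X\ge_n Y$ means $F_X^{[n]}(\eta)\le F_Y^{[n]}(\eta)$ for all $\eta\in\mathbb{R}$. For $X,Y\in\mathcal{X}_{[a,b]}$, $X\ge_n^{[a,b]}Y$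 means $F_X^{[n]}(\eta)\le F_Y^{[n]}(\eta)$ for all $\eta\in[a,b]$ and $F_X^{[k]}(b)\le F_Y^{[k]}(b)$ for all $k\in[n]$. $n$th degree $m$-mean preserving stochastic dominance: - For $X,Y\in\mathcal{X}_{[a,b]}$, $X$ dominates $Y$ in $(n,m)\mathrm{SD}_{[a,b]}$ if $X\ge_n^{[a,b]}Y$ and $F_X^{[k]}(b)\le F_Y^{[k]}(b)$ for all $k\in[n]$, with equality holding for all $k\in[m+1]$. - For $X,Y\in\mathcal{X}$, $X$ dominates $Y$ in $(n,m)\mathrm{SD}_{\mathbb{R}}$ if $X\ge_n Y$ and $\mathbb{E}[X^k]=\mathbb{E}[Y^k]$ for each $k\in[m]$. *)

theory Defs
  imports "HOL-Probability.Probability"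
begin

definition rv_on :: "'w measure \<Rightarrow> real \<Rightarrow> real \<Rightarrow> ('w \<Rightarrow> real) set" where
  "rv_on M a b = {X \<in> borel_measurable M. \<forall>\<omega>\<in>space M. X \<omega> \<in> {a..b}}"

text \<open>The underlying probability space carries every distribution supported in $[a,b]$,
  as an atomless space does.\<close>

definition rich_on :: "'w measure \<Rightarrow> real \<Rightarrow> real \<Rightarrow> bool" where
  "rich_on M a b \<longleftrightarrow>
     (\<forall>D. real_distribution D \<and> measure D {a..b} = 1 \<longrightarrow>
        (\<exists>X\<in>rv_on M a b. distr M borel X = D))"

definition dist_fun :: "'w measure \<Rightarrow> ('w \<Rightarrow> real) \<Rightarrow> real \<Rightarrow> real" where
  "dist_fun M X = cdf (distr M borel X)"

text \<open>\<open>iter_cdf k F\<close> is $F^{[k]}$. The index starts at 1, the value at 0 is a dummy.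
  The Lebesgue integral is 0 for non-integrable functions; all the integrals
  converge when \<open>F\<close> is the distribution function of a bounded random variable.\<close>

fun iter_cdf :: "nat \<Rightarrow> (real \<Rightarrow> real) \<Rightarrow> real \<Rightarrow> real" where
  "iter_cdf 0 F \<eta> = F \<eta>"
| "iter_cdf (Suc 0) F \<eta> = F \<eta>"
| "iter_cdf (Suc (Suc k)) F \<eta> = (LINT \<xi>:{..\<eta>}|lborel. iter_cdf (Suc k) F \<xi>)"

text \<open>The relations on the whole line are meant for bounded random variables, those
  with parameters \<open>a\<close>, \<open>b\<close> for elements of \<open>rv_on M a b\<close>.\<close>

definition sd_real :: "'w measure \<Rightarrow> nat \<Rightarrow> ('w \<Rightarrow> real) \<Rightarrow> ('w \<Rightarrow> real) \<Rightarrow> bool" where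
  "sd_real M n X Y \<longleftrightarrow>
     (\<forall>\<eta>. iter_cdf n (dist_fun M X) \<eta> \<le> iter_cdf n (dist_fun M Y) \<eta>)"

definition sd_interval ::
  "'w measure \<Rightarrow> real \<Rightarrow> real \<Rightarrow> nat \<Rightarrow> ('w \<Rightarrow> real) \<Rightarrow> ('w \<Rightarrow> real) \<Rightarrow> bool" where
  "sd_interval M a b n X Y \<longleftrightarrow>
     (\<forall>\<eta>\<in>{a..b}. iter_cdf n (dist_fun M X) \<eta> \<le> iter_cdf n (dist_fun M Y) \<eta>) \<and>
     (\<forall>k\<in>{1..n}. iter_cdf k (dist_fun M X) b \<le> iter_cdf k (dist_fun M Y) b)"

definition mp_sd_interval ::
  "'w measure \<Rightarrow> real \<Rightarrow> real \<Rightarrow> nat \<Rightarrow> nat \<Rightarrow> ('w \<Rightarrow> real) \<Rightarrow> ('w \<Rightarrow> real) \<Rightarrow> bool" where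
  "mp_sd_interval M a b n m X Y \<longleftrightarrow>
     sd_interval M a b n X Y \<and>
     (\<forall>k\<in>{1..n}. iter_cdf k (dist_fun M X) b \<le> iter_cdf k (dist_fun M Y) b) \<and>
     (\<forall>k\<in>{1..m+1}. iter_cdf k (dist_fun M X) b = iter_cdf k (dist_fun M Y) b)"

definition mp_sd_real ::
  "'w measure \<Rightarrow> nat \<Rightarrow> nat \<Rightarrow> ('w \<Rightarrow> real) \<Rightarrow> ('w \<Rightarrow> real) \<Rightarrow> bool" where
  "mp_sd_real M n m X Y \<longleftrightarrow>
     sd_real M n X Y \<and>
     (\<forall>k\<in>{1..m}. (LINT \<omega>|M. X \<omega> ^ k) = (LINT \<omega>|M. Y \<omega> ^ k))"

end

theory Submission
  imports Defs
begin

text \<open>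
  For \<open>X\<close> with values in \<open>[a, b]\<close>, Tonelli's theorem gives
  \<open>F\<^bsup>[k+1]\<^esup>(\<eta>) = E (\<eta> - X)\<^sub>+ ^ k / k!\<close> (lemma \<open>iter_cdf_eq_expectation\<close>). To the left of \<open>a\<close> this
  vanishes, and to the right of \<open>b\<close> the truncation is void, so the binomial theorem yields
  \<open>F\<^bsup>[n]\<^esup>(b + t) = (\<Sum>j<n. t ^ j / j! * F\<^bsup>[n-j]\<^esup>(b))\<close> (lemma \<open>iter_cdf_Taylor\<close>). Equality of the first
  \<open>m\<close> moments means equality of \<open>F\<^bsup>[k]\<^esup>(b)\<close> for \<open>k \<le> m + 1\<close>. Write \<open>d\<^sub>k\<close> for the difference at \<open>b\<close> of the
  \<open>k\<close>-th iterated distribution functions of \<open>X\<close> and \<open>Y\<close>.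

  Interval dominance says \<open>d\<^sub>k \<le> 0\<close> for all \<open>k \<le> n\<close>, so the expansion is nonpositive for \<open>t \<ge> 0\<close>.
  Conversely, dominance on the line says only that the polynomial \<open>(\<Sum>j<n. t ^ j / j! * d\<^bsub>n-j\<^esub>)\<close>,
  of degree at most \<open>n - m - 2\<close>, is nonpositive on \<open>[0, \<infinity>)\<close>. If \<open>n - m \<le> 3\<close>, it is at most linear,
  and this forces both coefficients to be nonpositive.

  If \<open>n - m \<ge> 4\<close>, it may be quadratic with a positive linear coefficient. To realise such a
  difference, take a polynomial \<open>\<phi> \<ge> 0\<close> on \<open>[a, b]\<close> whose derivatives of orders 0 to \<open>n - 1\<close> vanish at
  \<open>a\<close>, those of orders 3 to \<open>n - 1\<close> vanish at \<open>b\<close>, with \<open>\<phi>'(b) < 0\<close>, and whose quadratic expansion at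
  \<open>b\<close> is nonnegative to the right (lemma \<open>exists_witness_poly\<close>). With \<open>Y\<close> uniform on \<open>[a, b]\<close> and
  \<open>X\<close> of density \<open>1 / (b - a) - \<epsilon> \<phi>\<^bsup>(n)\<^esup>\<close> for a small \<open>\<epsilon> > 0\<close>, Taylor's formula shows that the
  difference of the \<open>k\<close>-th iterated distribution functions on \<open>[a, b]\<close> is \<open>- \<epsilon> \<phi>\<^bsup>(n-k)\<^esup>\<close>
  (lemma \<open>rich_on_obtains_perturbation\<close>). Thus \<open>X\<close> dominates \<open>Y\<close> on the line, but
  \<open>d\<^bsub>n-1\<^esub> = - \<epsilon> \<phi>'(b) > 0\<close>.
\<close>

section \<open>Iterated distribution functions as expectations\<close>

text \<open>The normalised truncated power \<open>(\<eta> - x)\<^sub>+ ^ k / k!\<close>; for \<open>k = 0\<close> it is the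
  indicator of \<open>x \<le> \<eta>\<close>, so that the case \<open>k = 0\<close> below is the distribution function itself.\<close>

definition trunc_pow :: "nat \<Rightarrow> real \<Rightarrow> real \<Rightarrow> real" where
  "trunc_pow k \<eta> x = (if x \<le> \<eta> then (\<eta> - x) ^ k / fact k else 0)"

lemma trunc_pow_nonneg: "0 \<le> trunc_pow k \<eta> x"
  by (simp add: trunc_pow_def)

lemma trunc_pow_le:
  assumes "a \<le> x"
  shows "trunc_pow k \<eta> x \<le> \<bar>\<eta> - a\<bar> ^ k / fact k"
  using assms by (auto simp: trunc_pow_def intro!: divide_right_mono power_mono)

lemma measurable_trunc_pow_pair [measurable]:
  assumes [measurable]: "X \<in> borel_measurable M"
  shows "(\<lambda>p. trunc_pow k (fst p) (X (snd p))) \<in> borel_measurable (borel \<Otimes>\<^sub>M M)"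
  unfolding trunc_pow_def by measurable

lemma measurable_trunc_pow [measurable]:
  assumes [measurable]: "X \<in> borel_measurable M"
  shows "(\<lambda>\<omega>. trunc_pow k \<eta> (X \<omega>)) \<in> borel_measurable M"
  unfolding trunc_pow_def by measurable

lemma continuous_on_trunc_pow: "continuous_on A (trunc_pow (Suc k) \<eta>)"
proof -
  have "trunc_pow (Suc k) \<eta> = (\<lambda>x. max 0 (\<eta> - x) ^ Suc k / fact (Suc k))"
    by (auto simp: trunc_pow_def max_def)
  then show ?thesis by (auto intro!: continuous_intros)
qed

lemma nn_integral_trunc_pow:
  "(\<integral>\<^sup>+\<xi>. ennreal (trunc_pow k \<xi> x) * indicator {..\<eta>} \<xi> \<partial>lborel)
     = ennreal (trunc_pow (Suc k) \<eta> x)"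
proof (cases "x \<le> \<eta>")
  case True
  have "(\<integral>\<^sup>+\<xi>. ennreal (trunc_pow k \<xi> x) * indicator {..\<eta>} \<xi> \<partial>lborel)
      = (\<integral>\<^sup>+\<xi>. ennreal ((\<xi> - x) ^ k / fact k) * indicator {x..\<eta>} \<xi> \<partial>lborel)"
    by (intro nn_integral_cong) (auto simp: trunc_pow_def indicator_def)
  also have "\<dots> = ennreal ((\<eta> - x) ^ Suc k / fact (Suc k) - (x - x) ^ Suc k / fact (Suc k))"
  proof (rule nn_integral_FTC_Icc[where F = "\<lambda>\<xi>. (\<xi> - x) ^ Suc k / fact (Suc k)"])
    show "((\<lambda>\<xi>. (\<xi> - x) ^ Suc k / fact (Suc k)) has_real_derivative (\<xi> - x) ^ k / fact k)
        (at \<xi>)" for \<xi>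
    proof -
      have "((\<lambda>\<xi>. \<xi> - x) has_real_derivative 1) (at \<xi>)"
        by (auto intro!: derivative_eq_intros)
      from DERIV_cdivide[OF DERIV_power_Suc[OF this, of k], of "fact (Suc k)"] show ?thesis
        by (simp add: add_nonneg_eq_0_iff del: power_Suc)
    qed
  qed (use True in auto)
  finally show ?thesis using True by (simp add: trunc_pow_def)
next
  case False
  have "(\<integral>\<^sup>+\<xi>. ennreal (trunc_pow k \<xi> x) * indicator {..\<eta>} \<xi> \<partial>lborel) = (\<integral>\<^sup>+\<xi>. 0 \<partial>(lborel :: real measure))"
    using False by (intro nn_integral_cong) (auto simp: trunc_pow_def indicator_def)
  then show ?thesis using False by (simp add: trunc_pow_def)
qed

lemma (in prob_space) integrable_trunc_pow:
  assumes "X \<in> rv_on M a b"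
  shows "integrable M (\<lambda>\<omega>. trunc_pow k \<eta> (X \<omega>))"
proof (rule integrable_const_bound[where B = "\<bar>\<eta> - a\<bar> ^ k / fact k"])
  have [measurable]: "X \<in> borel_measurable M"
    using assms by (simp add: rv_on_def)
  show "(\<lambda>\<omega>. trunc_pow k \<eta> (X \<omega>)) \<in> borel_measurable M" by measurable
  show "AE \<omega> in M. norm (trunc_pow k \<eta> (X \<omega>)) \<le> \<bar>\<eta> - a\<bar> ^ k / fact k"
    using assms by (intro AE_I2) (auto simp: rv_on_def trunc_pow_nonneg intro!: trunc_pow_le)
qed

text \<open>By Tonelli, integration in \<open>\<eta>\<close> commutes with the expectation and raises the exponent of
  the truncated power by one.\<close>

lemma (in prob_space) iter_cdf_eq_expectation:
  assumes X: "X \<in> rv_on M a b"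
  shows "iter_cdf (Suc k) (dist_fun M X) \<eta> = (LINT \<omega>|M. trunc_pow k \<eta> (X \<omega>))"
proof (induction k arbitrary: \<eta>)
  case 0
  have [measurable]: "X \<in> borel_measurable M"
    using X by (simp add: rv_on_def)
  have "(LINT \<omega>|M. trunc_pow 0 \<eta> (X \<omega>)) = (LINT \<omega>|M. indicator (X -` {..\<eta>} \<inter> space M) \<omega>)"
    by (intro Bochner_Integration.integral_cong) (auto simp: trunc_pow_def indicator_def)
  also have "\<dots> = measure M (X -` {..\<eta>} \<inter> space M)"
    by simp
  also have "\<dots> = dist_fun M X \<eta>"
    by (simp add: dist_fun_def cdf_def measure_distr)
  finally show ?case by simp
next
  case (Suc k)
  have [measurable]: "X \<in> borel_measurable M"
    using X by (simp add: rv_on_def)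
  interpret P: pair_sigma_finite lborel M
    by unfold_locales
  have [measurable]: "(\<lambda>p. trunc_pow k (fst p) (X (snd p))) \<in> borel_measurable (lborel \<Otimes>\<^sub>M M)"
    by (subst measurable_cong_sets[OF sets_pair_measure_cong refl, of _ borel _ M]) auto
  have [measurable]: "(\<lambda>\<xi>. LINT \<omega>|M. trunc_pow k \<xi> (X \<omega>)) \<in> borel_measurable borel"
    by (rule borel_measurable_lebesgue_integral) (simp add: split_beta')
  have "iter_cdf (Suc (Suc k)) (dist_fun M X) \<eta>
      = (LINT \<xi>|lborel. indicator {..\<eta>} \<xi> * (LINT \<omega>|M. trunc_pow k \<xi> (X \<omega>)))"
    by (simp add: Suc.IH set_lebesgue_integral_def)
  also have "\<dots> = enn2real (\<integral>\<^sup>+\<xi>. ennreal (indicator {..\<eta>} \<xi> * (LINT \<omega>|M. trunc_pow k \<xi> (X \<omega>))) \<partial>lborel)"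
    by (intro integral_eq_nn_integral)
      (auto intro!: mult_nonneg_nonneg integral_nonneg simp: trunc_pow_nonneg)
  also have "(\<integral>\<^sup>+\<xi>. ennreal (indicator {..\<eta>} \<xi> * (LINT \<omega>|M. trunc_pow k \<xi> (X \<omega>))) \<partial>lborel)
      = (\<integral>\<^sup>+\<xi>. (\<integral>\<^sup>+\<omega>. ennreal (trunc_pow k \<xi> (X \<omega>)) * indicator {..\<eta>} \<xi> \<partial>M) \<partial>lborel)"
  proof (intro nn_integral_cong)
    fix \<xi> :: real
    have "(\<integral>\<^sup>+\<omega>. ennreal (trunc_pow k \<xi> (X \<omega>)) \<partial>M) = ennreal (LINT \<omega>|M. trunc_pow k \<xi> (X \<omega>))"
      by (intro nn_integral_eq_integral integrable_trunc_pow[OF X]) (simp add: trunc_pow_nonneg)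
    then show "ennreal (indicator {..\<eta>} \<xi> * (LINT \<omega>|M. trunc_pow k \<xi> (X \<omega>)))
        = (\<integral>\<^sup>+\<omega>. ennreal (trunc_pow k \<xi> (X \<omega>)) * indicator {..\<eta>} \<xi> \<partial>M)"
      by (auto simp: indicator_def)
  qed
  also have "\<dots> = (\<integral>\<^sup>+\<omega>. (\<integral>\<^sup>+\<xi>. ennreal (trunc_pow k \<xi> (X \<omega>)) * indicator {..\<eta>} \<xi> \<partial>lborel) \<partial>M)"
    by (rule P.Fubini'[symmetric]) (simp add: split_beta')
  also have "\<dots> = (\<integral>\<^sup>+\<omega>. ennreal (trunc_pow (Suc k) \<eta> (X \<omega>)) \<partial>M)"
    by (simp add: nn_integral_trunc_pow)
  also have "\<dots> = ennreal (LINT \<omega>|M. trunc_pow (Suc k) \<eta> (X \<omega>))"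
    by (intro nn_integral_eq_integral integrable_trunc_pow[OF X]) (simp add: trunc_pow_nonneg)
  finally show ?case
    by (simp add: integral_nonneg trunc_pow_nonneg)
qed

lemma (in prob_space) iter_cdf_left_of_support:
  assumes X: "X \<in> rv_on M a b" and "\<eta> < a"
  shows "iter_cdf (Suc k) (dist_fun M X) \<eta> = 0"
proof -
  have "(LINT \<omega>|M. trunc_pow k \<eta> (X \<omega>)) = (LINT \<omega>|M. 0)"
    using assms by (intro Bochner_Integration.integral_cong) (auto simp: trunc_pow_def rv_on_def)
  then show ?thesis by (simp add: iter_cdf_eq_expectation[OF X])
qed

lemma (in prob_space) integrable_power_diff:
  assumes X: "X \<in> rv_on M a b"
  shows "integrable M (\<lambda>\<omega>. (c - X \<omega>) ^ k)"
proof (rule integrable_const_bound[where B = "(\<bar>c\<bar> + \<bar>a\<bar> + \<bar>b\<bar>) ^ k"])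
  have [measurable]: "X \<in> borel_measurable M"
    using assms by (simp add: rv_on_def)
  show "(\<lambda>\<omega>. (c - X \<omega>) ^ k) \<in> borel_measurable M" by measurable
  have "\<bar>c - x\<bar> ^ k \<le> (\<bar>c\<bar> + \<bar>a\<bar> + \<bar>b\<bar>) ^ k" if "a \<le> x" "x \<le> b" for x
    by (rule power_mono) (use that in auto)
  then show "AE \<omega> in M. norm ((c - X \<omega>) ^ k) \<le> (\<bar>c\<bar> + \<bar>a\<bar> + \<bar>b\<bar>) ^ k"
    using assms by (intro AE_I2) (auto simp: rv_on_def power_abs)
qed

lemma (in prob_space) iter_cdf_right_of_support:
  assumes X: "X \<in> rv_on M a b" and "b \<le> \<eta>"
  shows "iter_cdf (Suc k) (dist_fun M X) \<eta> = (LINT \<omega>|M. (\<eta> - X \<omega>) ^ k) / fact k"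
proof -
  have "(LINT \<omega>|M. trunc_pow k \<eta> (X \<omega>)) = (LINT \<omega>|M. (\<eta> - X \<omega>) ^ k / fact k)"
    using assms by (intro Bochner_Integration.integral_cong) (auto simp: trunc_pow_def rv_on_def)
  then show ?thesis by (simp add: iter_cdf_eq_expectation[OF X])
qed

section \<open>Moments about different points\<close>

lemma (in prob_space) expectation_power_shift:
  assumes X: "X \<in> rv_on M a b"
  shows "(LINT \<omega>|M. (d - X \<omega>) ^ k)
    = (\<Sum>j\<le>k. of_nat (k choose j) * (d - c) ^ j * (LINT \<omega>|M. (c - X \<omega>) ^ (k - j)))"
proof -
  have "(d - X \<omega>) ^ k = (\<Sum>j\<le>k. of_nat (k choose j) * (d - c) ^ j * (c - X \<omega>) ^ (k - j))" for \<omega>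
    using binomial_ring[of "d - c" "c - X \<omega>" k] by simp
  then have "(LINT \<omega>|M. (d - X \<omega>) ^ k)
      = (LINT \<omega>|M. (\<Sum>j\<le>k. of_nat (k choose j) * (d - c) ^ j * (c - X \<omega>) ^ (k - j)))"
    by simp
  also have "\<dots> = (\<Sum>j\<le>k. LINT \<omega>|M. of_nat (k choose j) * (d - c) ^ j * (c - X \<omega>) ^ (k - j))"
    by (intro Bochner_Integration.integral_sum integrable_mult_right integrable_power_diff[OF X])
  finally show ?thesis by simp
qed

lemma (in prob_space) moments_eq_shift:
  assumes X: "X \<in> rv_on M a b" and Y: "Y \<in> rv_on M a b"
    and eq: "\<And>k. k \<le> m \<Longrightarrow> (LINT \<omega>|M. (c - X \<omega>) ^ k) = (LINT \<omega>|M. (c - Y \<omega>) ^ k)"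
    and "k \<le> m"
  shows "(LINT \<omega>|M. (d - X \<omega>) ^ k) = (LINT \<omega>|M. (d - Y \<omega>) ^ k)"
  unfolding expectation_power_shift[OF X, of d k c] expectation_power_shift[OF Y, of d k c]
  using \<open>k \<le> m\<close> by (intro sum.cong refl arg_cong2[where f = "(*)"] eq) auto

text \<open>Equality of the raw moments of orders 1 to \<open>m\<close> is the equality of the iterated distribution
  functions at \<open>b\<close> in degrees 1 to \<open>m + 1\<close>; the added case \<open>k = 0\<close> is trivial.\<close>

lemma (in prob_space) moments_eq_iff_iter_cdf_eq:
  assumes X: "X \<in> rv_on M a b" and Y: "Y \<in> rv_on M a b"
  shows "(\<forall>k\<in>{1..m}. (LINT \<omega>|M. X \<omega> ^ k) = (LINT \<omega>|M. Y \<omega> ^ k)) \<longleftrightarrow>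
    (\<forall>k\<le>m. iter_cdf (Suc k) (dist_fun M X) b = iter_cdf (Suc k) (dist_fun M Y) b)"
proof -
  have neg: "(LINT \<omega>|M. (0 - Z \<omega>) ^ k) = (- 1) ^ k * (LINT \<omega>|M. Z \<omega> ^ k)" for k and Z :: "'a \<Rightarrow> real"
  proof -
    have "(0 - Z \<omega>) ^ k = (- 1) ^ k * Z \<omega> ^ k" for \<omega>
      by (simp add: power_minus[of "Z \<omega>"])
    then show ?thesis by simp
  qed
  have "(\<forall>k\<in>{1..m}. (LINT \<omega>|M. X \<omega> ^ k) = (LINT \<omega>|M. Y \<omega> ^ k)) \<longleftrightarrow>
      (\<forall>k\<le>m. (LINT \<omega>|M. X \<omega> ^ k) = (LINT \<omega>|M. Y \<omega> ^ k))"
  proof (intro iffI allI impI ballI)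
    fix k assume "\<forall>k\<in>{1..m}. (LINT \<omega>|M. X \<omega> ^ k) = (LINT \<omega>|M. Y \<omega> ^ k)" "k \<le> m"
    then show "(LINT \<omega>|M. X \<omega> ^ k) = (LINT \<omega>|M. Y \<omega> ^ k)"
      by (cases "k = 0") auto
  qed auto
  also have "\<dots> \<longleftrightarrow> (\<forall>k\<le>m. (LINT \<omega>|M. (0 - X \<omega>) ^ k) = (LINT \<omega>|M. (0 - Y \<omega>) ^ k))"
    by (simp only: neg) simp
  also have "\<dots> \<longleftrightarrow> (\<forall>k\<le>m. (LINT \<omega>|M. (b - X \<omega>) ^ k) = (LINT \<omega>|M. (b - Y \<omega>) ^ k))"
  proof (intro iffI allI impI)
    fix k assume "\<forall>k\<le>m. (LINT \<omega>|M. (0 - X \<omega>) ^ k) = (LINT \<omega>|M. (0 - Y \<omega>) ^ k)" "k \<le> m"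
    then show "(LINT \<omega>|M. (b - X \<omega>) ^ k) = (LINT \<omega>|M. (b - Y \<omega>) ^ k)"
      by (intro moments_eq_shift[OF X Y, of m 0 k b]) auto
  next
    fix k assume "\<forall>k\<le>m. (LINT \<omega>|M. (b - X \<omega>) ^ k) = (LINT \<omega>|M. (b - Y \<omega>) ^ k)" "k \<le> m"
    then show "(LINT \<omega>|M. (0 - X \<omega>) ^ k) = (LINT \<omega>|M. (0 - Y \<omega>) ^ k)"
      by (intro moments_eq_shift[OF X Y, of m b k 0]) auto
  qed
  finally show ?thesis
    by (simp add: iter_cdf_right_of_support[OF X] iter_cdf_right_of_support[OF Y])
qed

text \<open>To the right of \<open>b\<close> an iterated distribution function is the polynomial given by its own
  Taylor expansion at \<open>b\<close>.\<close>

lemma (in prob_space) iter_cdf_Taylor: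
  assumes X: "X \<in> rv_on M a b" and "0 \<le> t"
  shows "iter_cdf (Suc k) (dist_fun M X) (b + t)
    = (\<Sum>j\<le>k. t ^ j / fact j * iter_cdf (Suc (k - j)) (dist_fun M X) b)"
proof -
  have *: "of_nat (k choose j) * u * v / fact k = u / fact j * (v / fact (k - j))"
    if "j \<le> k" for j and u v :: real
    using that by (simp add: binomial_fact)
  show ?thesis
    using \<open>0 \<le> t\<close> * by (simp add: iter_cdf_right_of_support[OF X] expectation_power_shift[OF X, of "b + t" k b]
        sum_divide_distrib)
qed

section \<open>A polynomial that is nonnegative but decreasing at the right endpoint\<close>

lemma exists_antiderivative_poly:
  fixes p :: "real poly"
  obtains q where "pderiv q = p" and "poly q a = 0"
proof -
  define q where "q = (\<Sum>i\<le>degree p. monom (coeff p i / real (Suc i)) (Suc i))"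
  have "pderiv q = (\<Sum>i\<le>degree p. monom (coeff p i) i)"
    using higher_pderiv_sum[of 1 "\<lambda>i. monom (coeff p i / real (Suc i)) (Suc i)" "{..degree p}"]
    by (simp add: q_def pderiv_monom del: of_nat_Suc)
  then have "pderiv q = p"
    by (simp add: poly_as_sum_of_monoms)
  then show thesis
    by (intro that[of "q - [:poly q a:]"]) (simp_all add: pderiv_diff pderiv_pCons)
qed

lemma poly_higher_pderiv_power_eq_0:
  fixes q :: "real poly"
  assumes "poly q x = 0" and "i < N"
  shows "poly ((pderiv ^^ i) (q ^ N)) x = 0"
proof -
  have "q ^ (N - i) dvd (pderiv ^^ i) (q ^ N)" if "i \<le> N" for i
    using that
  proof (induction i)
    case (Suc i)
    then obtain r where r: "(pderiv ^^ i) (q ^ N) = q ^ Suc (N - Suc i) * r"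
      by (metis Suc_diff_Suc Suc_le_lessD dvdE less_imp_le_nat)
    have "pderiv (q ^ Suc (N - Suc i) * r)
        = q ^ (N - Suc i) * (q * pderiv r + smult (of_nat (Suc (N - Suc i))) (pderiv q) * r)"
      unfolding pderiv_mult pderiv_power_Suc by (simp add: algebra_simps)
    then show ?case
      by (simp add: r)
  qed simp
  from this[of i] obtain r where "(pderiv ^^ i) (q ^ N) = q ^ (N - i) * r"
    using \<open>i < N\<close> by (auto elim: dvdE)
  then show ?thesis
    using assms by simp
qed

lemma poly_mono_of_pderiv_nonneg:
  fixes p :: "real poly"
  assumes "\<And>x. x \<in> {a..b} \<Longrightarrow> 0 \<le> poly (pderiv p) x" and "a \<le> x" "x \<le> y" "y \<le> b"
  shows "poly p x \<le> poly p y"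
  using assms by (intro DERIV_nonneg_imp_nondecreasing[of x y "poly p"])
    (auto intro!: exI[of _ "poly (pderiv p) _"] poly_DERIV)

text \<open>With \<open>L = b - a\<close> and a polynomial \<open>R\<close> that vanishes to high order at \<open>a\<close> and whose third
  derivative is \<open>((x - a) (b - x))\<^sup>N\<close>, the polynomial is \<open>\<phi> = 4 L\<^sup>2 R'' - 2 L R' + R\<close>. As \<open>R''\<close>
  increases, \<open>R' \<le> L R''\<close> on \<open>[a, b]\<close>, which gives \<open>\<phi> \<ge> 0\<close> there. At \<open>b\<close> the derivatives of
  order 3 and higher vanish, and the remaining quadratic expansion is at least
  \<open>R''(b) (t - 2 L)\<^sup>2 / 2\<close>, although \<open>\<phi>'(b) = - 2 L R''(b) + R'(b) < 0\<close>.\<close>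

lemma exists_witness_poly:
  fixes a b :: real
  assumes "a < b" and "2 \<le> N"
  obtains \<phi> :: "real poly" where
    "\<And>j. j < N \<Longrightarrow> poly ((pderiv ^^ j) \<phi>) a = 0"
    "\<And>j. 3 \<le> j \<Longrightarrow> j < N \<Longrightarrow> poly ((pderiv ^^ j) \<phi>) b = 0"
    "\<And>x. x \<in> {a..b} \<Longrightarrow> 0 \<le> poly \<phi> x"
    "\<And>t. 0 \<le> t \<Longrightarrow>
      0 \<le> poly \<phi> b + t * poly (pderiv \<phi>) b + t\<^sup>2 / 2 * poly (pderiv (pderiv \<phi>)) b"
    "poly (pderiv \<phi>) b < 0"
proof -
  define L where "L = b - a"
  have L: "0 < L" using assms by (simp add: L_def)
  define B where "B = ([:- a, 1:] * [:b, - 1:]) ^ N"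
  have poly_B: "poly B x = ((x - a) * (b - x)) ^ N" for x
    by (simp add: B_def algebra_simps)
  have B_deriv_a: "poly ((pderiv ^^ i) B) a = 0" and B_deriv_b: "poly ((pderiv ^^ i) B) b = 0"
    if "i < N" for i
    using that unfolding B_def by (auto intro!: poly_higher_pderiv_power_eq_0)
  obtain R2 where R2: "pderiv R2 = B" "poly R2 a = 0" by (rule exists_antiderivative_poly)
  obtain R1 where R1: "pderiv R1 = R2" "poly R1 a = 0" by (rule exists_antiderivative_poly)
  obtain R where R: "pderiv R = R1" "poly R a = 0" by (rule exists_antiderivative_poly)
  define \<phi> where "\<phi> = smult (4 * L\<^sup>2) R2 - smult (2 * L) R1 + R"

  have B_nonneg: "0 \<le> poly B x" if "x \<in> {a..b}" for x
    using that by (simp add: poly_B)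
  have R2_mono: "poly R2 x \<le> poly R2 y" if "a \<le> x" "x \<le> y" "y \<le> b" for x y
    using that B_nonneg by (intro poly_mono_of_pderiv_nonneg[of a b]) (auto simp: R2)
  have R2_nonneg: "0 \<le> poly R2 x" if "x \<in> {a..b}" for x
    using R2_mono[of a x] that R2 by simp
  have R1_nonneg: "0 \<le> poly R1 x" if "x \<in> {a..b}" for x
    using poly_mono_of_pderiv_nonneg[of a b R1 a x] that R1 R2_nonneg by simp
  have R_nonneg: "0 \<le> poly R x" if "x \<in> {a..b}" for x
    using poly_mono_of_pderiv_nonneg[of a b R a x] that R R1_nonneg by simp
  have R1_le: "poly R1 x \<le> L * poly R2 x" if x: "x \<in> {a..b}" for x
  proof (cases "x = a")
    case False
    then obtain z where z: "a < z" "z < x" "poly R1 x - poly R1 a = (x - a) * poly (pderiv R1) z"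
      using poly_MVT[of a x R1] x by auto
    have "(x - a) * poly R2 z \<le> L * poly R2 x"
      using x z R2_mono[of z x] R2_nonneg[of z] by (intro mult_mono) (auto simp: L_def)
    then show ?thesis using z R1 by simp
  qed (use R1 R2 in simp)
  have R2_pos: "0 < poly R2 b"
  proof -
    obtain z where z: "a < z" "z < b" "poly R2 b - poly R2 a = (b - a) * poly (pderiv R2) z"
      using poly_MVT[of a b R2] assms by auto
    then show ?thesis using R2 by (simp add: poly_B)
  qed

  have B_b: "poly B b = 0" and B'_b: "poly (pderiv B) b = 0"
    using B_deriv_b[of 0] B_deriv_b[of 1] \<open>2 \<le> N\<close> by simp_all
  have \<phi>_b: "poly \<phi> b = 4 * L\<^sup>2 * poly R2 b - 2 * L * poly R1 b + poly R b"
    by (simp add: \<phi>_def)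
  have \<phi>'_b: "poly (pderiv \<phi>) b = - 2 * L * poly R2 b + poly R1 b"
    by (simp add: \<phi>_def pderiv_add pderiv_diff pderiv_smult R R1 R2 B_b)
  have \<phi>''_b: "poly (pderiv (pderiv \<phi>)) b = poly R2 b"
    by (simp add: \<phi>_def pderiv_add pderiv_diff pderiv_smult R R1 R2 B_b B'_b)
  have \<phi>_deriv: "(pderiv ^^ j) \<phi> = smult (4 * L\<^sup>2) ((pderiv ^^ j) R2)
      - smult (2 * L) ((pderiv ^^ j) R1) + (pderiv ^^ j) R" for j
    unfolding \<phi>_def diff_conv_add_uminus smult_minus_left[symmetric]
    by (simp only: higher_pderiv_add higher_pderiv_smult)

  show thesis
  proof (rule that[of \<phi>])
    fix j assume j: "j < N"
    have R2_deriv: "poly ((pderiv ^^ i) R2) a = 0" if "i < N" for i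
      using that R2 B_deriv_a by (cases i) (simp_all add: funpow_Suc_right del: funpow.simps)
    have R1_deriv: "poly ((pderiv ^^ i) R1) a = 0" if "i < N" for i
      using that R1 R2_deriv by (cases i) (simp_all add: funpow_Suc_right del: funpow.simps)
    have R_deriv: "poly ((pderiv ^^ i) R) a = 0" if "i < N" for i
      using that R R1_deriv by (cases i) (simp_all add: funpow_Suc_right del: funpow.simps)
    show "poly ((pderiv ^^ j) \<phi>) a = 0"
      using j by (simp add: \<phi>_deriv R2_deriv R1_deriv R_deriv)
  next
    fix j assume j: "3 \<le> j" "j < N"
    then obtain i where i: "j = Suc (Suc (Suc i))"
      by (metis Suc_le_D numeral_3_eq_3 Suc_le_mono)
    have "(pderiv ^^ j) R2 = (pderiv ^^ Suc (Suc i)) B" "(pderiv ^^ j) R1 = (pderiv ^^ Suc i) B"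
      "(pderiv ^^ j) R = (pderiv ^^ i) B"
      by (simp_all add: i funpow_Suc_right R R1 R2 del: funpow.simps)
    moreover have "i < N" "Suc i < N" "Suc (Suc i) < N"
      using j i by simp_all
    ultimately show "poly ((pderiv ^^ j) \<phi>) b = 0"
      by (simp add: \<phi>_deriv B_deriv_b del: funpow.simps)
  next
    fix x assume x: "x \<in> {a..b}"
    have "2 * L * poly R1 x \<le> 2 * L * (L * poly R2 x)"
      using R1_le[OF x] L by (intro mult_left_mono) auto
    also have "\<dots> \<le> 4 * L\<^sup>2 * poly R2 x"
      using R2_nonneg[OF x] L by (simp add: power2_eq_square)
    finally show "0 \<le> poly \<phi> x"
      using R_nonneg[OF x] by (simp add: \<phi>_def)
  next
    fix t :: real assume t: "0 \<le> t"
    have b: "b \<in> {a..b}" using assms by simp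
    have "2 * L * poly R1 b \<le> 2 * L * (L * poly R2 b)"
      using R1_le[OF b] L by (intro mult_left_mono) auto
    moreover have "0 \<le> t * poly R1 b"
      using t R1_nonneg[OF b] by simp
    moreover have "0 \<le> (t - 2 * L)\<^sup>2 * poly R2 b / 2"
      using R2_pos by simp
    ultimately show "0 \<le> poly \<phi> b + t * poly (pderiv \<phi>) b + t\<^sup>2 / 2 * poly (pderiv (pderiv \<phi>)) b"
      using R_nonneg[OF b] unfolding \<phi>_b \<phi>'_b \<phi>''_b
      by (simp add: power2_eq_square algebra_simps)
  next
    have "poly R1 b \<le> L * poly R2 b"
      using R1_le[of b] assms by simp
    moreover have "0 < L * poly R2 b"
      using L R2_pos by simp
    ultimately show "poly (pderiv \<phi>) b < 0"
      unfolding \<phi>'_b by simp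
  qed
qed

section \<open>Random variables with prescribed density\<close>

lemma rich_on_obtains_density:
  fixes f :: "real \<Rightarrow> real"
  assumes rich: "rich_on M a b"
    and cont: "continuous_on UNIV f"
    and nonneg: "\<And>x. x \<in> {a..b} \<Longrightarrow> 0 \<le> f x"
    and int: "integral {a..b} f = 1"
  obtains X where "X \<in> rv_on M a b"
    and "\<And>h. continuous_on UNIV h \<Longrightarrow> (LINT \<omega>|M. h (X \<omega>)) = integral {a..b} (\<lambda>x. h x * f x)"
proof -
  define g where "g x = indicator {a..b} x * f x" for x
  define D where "D = density lborel (\<lambda>x. ennreal (g x))"
  have [measurable]: "f \<in> borel_measurable borel"
    using cont by (rule borel_measurable_continuous_onI)
  have [measurable]: "g \<in> borel_measurable borel"
    unfolding g_def by measurable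
  have g_nonneg: "0 \<le> g x" for x
    using nonneg by (auto simp: g_def indicator_def)
  have fint: "set_integrable lborel {a..b} f"
    using cont by (intro borel_integrable_atLeastAtMost') (rule continuous_on_subset, auto)
  have g_int: "integrable lborel g" and g_one: "(LINT x|lborel. g x) = 1"
    using fint set_borel_integral_eq_integral[OF fint] int
    by (simp_all add: set_integrable_def set_lebesgue_integral_def g_def[abs_def])
  have mass: "(\<integral>\<^sup>+x. ennreal (g x) \<partial>lborel) = 1"
    using nn_integral_eq_integral[OF g_int] g_nonneg g_one by simp
  interpret D: prob_space D
    by (rule prob_spaceI) (simp add: D_def emeasure_density mass)
  have "real_distribution D"
    by unfold_locales (simp add: D_def)
  moreover have "measure D {a..b} = 1"
  proof -
    have "emeasure D {a..b} = (\<integral>\<^sup>+x. ennreal (g x) \<partial>lborel)"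
      unfolding D_def
      by (subst emeasure_density) (auto intro!: nn_integral_cong simp: g_def indicator_def)
    then show ?thesis by (simp add: mass measure_def)
  qed
  ultimately obtain X where X: "X \<in> rv_on M a b" "distr M borel X = D"
    using rich unfolding rich_on_def by blast
  have Xm: "X \<in> borel_measurable M"
    using X by (simp add: rv_on_def)
  show thesis
  proof (rule that[OF X(1)])
    fix h :: "real \<Rightarrow> real" assume h: "continuous_on UNIV h"
    have [measurable]: "h \<in> borel_measurable borel"
      using h by (rule borel_measurable_continuous_onI)
    have "(LINT \<omega>|M. h (X \<omega>)) = (LINT x|D. h x)"
      unfolding X(2)[symmetric] by (rule integral_distr[symmetric]) (use Xm in auto)
    also have "\<dots> = (LINT x|lborel. g x * h x)"
      unfolding D_def by (rule integral_real_density) (auto simp: g_nonneg)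
    also have "\<dots> = (LINT x:{a..b}|lborel. h x * f x)"
      by (simp add: set_lebesgue_integral_def g_def mult_ac)
    also have "\<dots> = integral {a..b} (\<lambda>x. h x * f x)"
      by (intro set_borel_integral_eq_integral borel_integrable_atLeastAtMost' continuous_on_mult)
        (use h cont continuous_on_subset in blast)+
    finally show "(LINT \<omega>|M. h (X \<omega>)) = integral {a..b} (\<lambda>x. h x * f x)" .
  qed
qed

text \<open>Integrating the \<open>N\<close>-th derivative of a polynomial against a truncated power undoes
  \<open>k + 1\<close> of the differentiations, by Taylor's formula at \<open>a\<close>.\<close>

lemma integral_trunc_pow_higher_pderiv:
  fixes \<phi> :: "real poly"
  assumes zero: "\<And>j. j < N \<Longrightarrow> poly ((pderiv ^^ j) \<phi>) a = 0"
    and "k < N" and \<eta>: "\<eta> \<in> {a..b}"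
  shows "integral {a..b} (\<lambda>x. trunc_pow k \<eta> x * poly ((pderiv ^^ N) \<phi>) x)
    = poly ((pderiv ^^ (N - Suc k)) \<phi>) \<eta>"
proof -
  define Df where "Df i = poly ((pderiv ^^ (N - Suc k + i)) \<phi>)" for i
  have N: "N = N - Suc k + Suc k"
    using \<open>k < N\<close> by simp
  have "((\<lambda>x. ((\<eta> - x) ^ (Suc k - 1) / fact (Suc k - 1)) *\<^sub>R Df (Suc k) x) has_integral
      Df 0 \<eta> - (\<Sum>i<Suc k. ((\<eta> - a) ^ i / fact i) *\<^sub>R Df i a)) {a..\<eta>}"
  proof (rule Taylor_has_integral)
    fix i t
    show "(Df i has_vector_derivative Df (Suc i) t) (at t within {a..\<eta>})"
      unfolding Df_def has_real_derivative_iff_has_vector_derivative[symmetric]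
      by (auto intro!: poly_DERIV DERIV_subset[of _ _ t UNIV])
  qed (use \<eta> in auto)
  moreover have "Df i a = 0" if "i < Suc k" for i
    using that \<open>k < N\<close> unfolding Df_def by (intro zero) auto
  moreover have "Df (Suc k) = poly ((pderiv ^^ N) \<phi>)"
    unfolding Df_def by (subst (2) N) (rule refl)
  ultimately have "((\<lambda>x. (\<eta> - x) ^ k / fact k * poly ((pderiv ^^ N) \<phi>) x) has_integral Df 0 \<eta>) {a..\<eta>}"
    by simp
  then have "((\<lambda>x. if x \<in> {a..\<eta>} then (\<eta> - x) ^ k / fact k * poly ((pderiv ^^ N) \<phi>) x else 0)
      has_integral Df 0 \<eta>) {a..b}"
    using \<eta> by (subst has_integral_restrict) auto
  then have "((\<lambda>x. trunc_pow k \<eta> x * poly ((pderiv ^^ N) \<phi>) x) has_integral Df 0 \<eta>) {a..b}"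
    by (rule has_integral_eq[rotated]) (auto simp: trunc_pow_def)
  then show ?thesis
    by (simp add: Df_def integral_unique)
qed

text \<open>\<open>Y\<close> is uniform on \<open>[a, b]\<close>, and \<open>X\<close> has the density \<open>1 / (b - a) - \<epsilon> \<phi>\<^bsup>(N)\<^esup>\<close> with \<open>\<epsilon>\<close> so
  small that it is nonnegative; it has total mass 1 because \<open>\<phi>\<^bsup>(N - 1)\<^esup>\<close> vanishes at \<open>a\<close> and \<open>b\<close>.\<close>

lemma (in prob_space) rich_on_obtains_perturbation:
  fixes \<phi> :: "real poly"
  assumes rich: "rich_on M a b" and "a < b" and "1 \<le> N"
    and zero_a: "\<And>j. j < N \<Longrightarrow> poly ((pderiv ^^ j) \<phi>) a = 0"
    and zero_b: "poly ((pderiv ^^ (N - 1)) \<phi>) b = 0"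
  obtains X Y \<epsilon> where "X \<in> rv_on M a b" and "Y \<in> rv_on M a b" and "0 < \<epsilon>"
    and "\<And>k \<eta>. 1 \<le> k \<Longrightarrow> k < N \<Longrightarrow> \<eta> \<in> {a..b} \<Longrightarrow>
      iter_cdf (Suc k) (dist_fun M X) \<eta>
        = iter_cdf (Suc k) (dist_fun M Y) \<eta> - \<epsilon> * poly ((pderiv ^^ (N - Suc k)) \<phi>) \<eta>"
proof -
  define L where "L = b - a"
  have L: "0 < L" using \<open>a < b\<close> by (simp add: L_def)
  define g where "g = poly ((pderiv ^^ N) \<phi>)"
  have g_cont: "continuous_on A g" for A
    unfolding g_def by (intro continuous_intros)
  have "bounded (g ` {a..b})"
    by (intro compact_imp_bounded compact_continuous_image g_cont compact_Icc)
  then obtain C where C: "0 < C" "\<And>x. x \<in> {a..b} \<Longrightarrow> \<bar>g x\<bar> \<le> C"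
    unfolding bounded_pos by auto
  define \<epsilon> where "\<epsilon> = 1 / (L * C)"
  have \<epsilon>: "0 < \<epsilon>" using L C by (simp add: \<epsilon>_def)
  have density_nonneg: "0 \<le> 1 / L - \<epsilon> * g x" if "x \<in> {a..b}" for x
  proof -
    have "\<epsilon> * g x \<le> \<epsilon> * C"
      using C(2)[OF that] \<epsilon> by (intro mult_left_mono) auto
    then show ?thesis using C L by (simp add: \<epsilon>_def)
  qed
  have "integral {a..b} g = integral {a..b} (\<lambda>x. trunc_pow 0 b x * g x)"
    by (intro integral_cong) (simp add: trunc_pow_def)
  also have "\<dots> = 0"
    using integral_trunc_pow_higher_pderiv[of N \<phi> a 0 b b, OF zero_a] zero_b \<open>1 \<le> N\<close> \<open>a < b\<close>
    by (simp add: g_def)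
  finally have g_zero: "integral {a..b} g = 0" .

  obtain Y where Y: "Y \<in> rv_on M a b"
    "\<And>h. continuous_on UNIV h \<Longrightarrow> (LINT \<omega>|M. h (Y \<omega>)) = integral {a..b} (\<lambda>x. h x * (1 / L))"
  proof (rule rich_on_obtains_density[OF rich, of "\<lambda>_. 1 / L"])
    show "integral {a..b} (\<lambda>_. 1 / L) = 1"
      using L by (simp add: L_def)
  qed (use L in auto)
  obtain X where X: "X \<in> rv_on M a b"
    "\<And>h. continuous_on UNIV h \<Longrightarrow>
      (LINT \<omega>|M. h (X \<omega>)) = integral {a..b} (\<lambda>x. h x * (1 / L - \<epsilon> * g x))"
  proof (rule rich_on_obtains_density[OF rich, of "\<lambda>x. 1 / L - \<epsilon> * g x"])
    have "integral {a..b} (\<lambda>x. 1 / L - \<epsilon> * g x)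
        = integral {a..b} (\<lambda>x. 1 / L) - integral {a..b} (\<lambda>x. \<epsilon> * g x)"
      by (intro integral_diff integrable_continuous_real continuous_intros g_cont)
    then show "integral {a..b} (\<lambda>x. 1 / L - \<epsilon> * g x) = 1"
      using L by (simp add: L_def g_zero)
  qed (use density_nonneg in \<open>auto intro!: continuous_intros g_cont\<close>)

  show thesis
  proof (rule that[OF X(1) Y(1) \<epsilon>])
    fix k \<eta> assume k: "1 \<le> k" "k < N" and \<eta>: "\<eta> \<in> {a..b}"
    have cont: "continuous_on A (trunc_pow k \<eta>)" for A
      using continuous_on_trunc_pow[of A "k - 1" \<eta>] k by simp
    have "iter_cdf (Suc k) (dist_fun M X) \<eta> - iter_cdf (Suc k) (dist_fun M Y) \<eta>
        = integral {a..b} (\<lambda>x. trunc_pow k \<eta> x * (1 / L - \<epsilon> * g x))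
          - integral {a..b} (\<lambda>x. trunc_pow k \<eta> x * (1 / L))"
      by (simp only: iter_cdf_eq_expectation[OF X(1)] iter_cdf_eq_expectation[OF Y(1)]
          X(2)[OF cont] Y(2)[OF cont])
    also have "\<dots> = integral {a..b} (\<lambda>x. trunc_pow k \<eta> x * (1 / L - \<epsilon> * g x)
          - trunc_pow k \<eta> x * (1 / L))"
      by (intro integral_diff[symmetric] integrable_continuous_real continuous_intros g_cont cont)
    also have "\<dots> = integral {a..b} (\<lambda>x. - \<epsilon> * (trunc_pow k \<eta> x * g x))"
      by (intro integral_cong) (simp add: algebra_simps)
    also have "\<dots> = - \<epsilon> * poly ((pderiv ^^ (N - Suc k)) \<phi>) \<eta>"
      using integral_trunc_pow_higher_pderiv[of N \<phi> a k \<eta> b, OF zero_a] k \<eta>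
      by (simp add: g_def)
    finally show "iter_cdf (Suc k) (dist_fun M X) \<eta>
        = iter_cdf (Suc k) (dist_fun M Y) \<eta> - \<epsilon> * poly ((pderiv ^^ (N - Suc k)) \<phi>) \<eta>"
      by simp
  qed
qed

section \<open>Comparison of the two dominance relations\<close>

text \<open>The Taylor coefficients at \<open>b\<close> of the difference are nonpositive, hence so is the
  difference to the right of \<open>b\<close>.\<close>

lemma (in prob_space) mp_sd_interval_imp_real:
  assumes X: "X \<in> rv_on M a b" and Y: "Y \<in> rv_on M a b"
    and "1 \<le> n" and dom: "mp_sd_interval M a b n m X Y"
  shows "mp_sd_real M n m X Y"
proof -
  define F where "F k = iter_cdf k (dist_fun M X)" for k
  define G where "G k = iter_cdf k (dist_fun M Y)" for k
  obtain N where n: "n = Suc N"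
    using \<open>1 \<le> n\<close> by (cases n) auto
  have inside: "F n \<eta> \<le> G n \<eta>" if "\<eta> \<in> {a..b}" for \<eta>
    using dom that by (auto simp: mp_sd_interval_def sd_interval_def F_def G_def)
  have at_b: "F k b \<le> G k b" if "k \<in> {1..n}" for k
    using dom that by (auto simp: mp_sd_interval_def F_def G_def)
  have eq_b: "F k b = G k b" if "k \<in> {1..m + 1}" for k
    using dom that by (auto simp: mp_sd_interval_def F_def G_def)
  have "F n \<eta> \<le> G n \<eta>" for \<eta>
  proof -
    consider "\<eta> < a" | "\<eta> \<in> {a..b}" | "b \<le> \<eta>"
      by fastforce
    then show ?thesis
    proof cases
      case 1
      then show ?thesis
        by (simp add: F_def G_def n iter_cdf_left_of_support[OF X] iter_cdf_left_of_support[OF Y])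
    next
      case 3
      then have "F n (b + (\<eta> - b)) \<le> G n (b + (\<eta> - b))"
        using at_b unfolding F_def G_def n
        by (subst iter_cdf_Taylor[OF X] iter_cdf_Taylor[OF Y], simp)+
          (intro sum_mono mult_left_mono, auto)
      then show ?thesis by simp
    qed (rule inside)
  qed
  moreover have "\<forall>k\<le>m. F (Suc k) b = G (Suc k) b"
    using eq_b by auto
  ultimately show ?thesis
    using moments_eq_iff_iter_cdf_eq[OF X Y] by (auto simp: mp_sd_real_def sd_real_def F_def G_def)
qed

text \<open>To the right of \<open>b\<close> the difference of the \<open>n\<close>-th iterated distribution functions is a
  polynomial of degree at most \<open>n - m - 2 \<le> 1\<close>. If it stays nonpositive, then so are its constant
  and its linear coefficient, which are the only ones not already known to vanish.\<close>

lemma (in prob_space) mp_sd_real_imp_interval: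
  assumes X: "X \<in> rv_on M a b" and Y: "Y \<in> rv_on M a b"
    and "m < n" and "n - m \<le> 3" and dom: "mp_sd_real M n m X Y"
  shows "mp_sd_interval M a b n m X Y"
proof -
  define F where "F k = iter_cdf k (dist_fun M X)" for k
  define G where "G k = iter_cdf k (dist_fun M Y)" for k
  have le: "F n \<eta> \<le> G n \<eta>" for \<eta>
    using dom by (simp add: mp_sd_real_def sd_real_def F_def G_def)
  have eq: "F (Suc k) b = G (Suc k) b" if "k \<le> m" for k
    using dom that moments_eq_iff_iter_cdf_eq[OF X Y, of m]
    by (simp add: mp_sd_real_def F_def G_def)
  have eq': "F k b = G k b" if "k \<in> {1..m + 1}" for k
    using eq[of "k - 1"] that by auto
  have le_b: "F k b \<le> G k b" if k: "k \<in> {1..n}" for k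
  proof -
    consider "k \<in> {1..m + 1}" | "k = n" | "n = m + 3" "k = m + 2"
      using k \<open>m < n\<close> \<open>n - m \<le> 3\<close> by fastforce
    then show ?thesis
    proof cases
      case 3
      define d where "d k = F k b - G k b" for k
      have "d (m + 3) + t * d (m + 2) \<le> 0" if "0 \<le> t" for t
      proof -
        have "F n (b + t) - G n (b + t) = (\<Sum>j\<le>m + 2. t ^ j / fact j * d (Suc (m + 2 - j)))"
          using iter_cdf_Taylor[OF X that, of "m + 2"] iter_cdf_Taylor[OF Y that, of "m + 2"]
          by (simp add: F_def G_def d_def 3 numeral_3_eq_3 numeral_2_eq_2 right_diff_distrib sum_subtractf
              del: iter_cdf.simps sum.atMost_Suc)
        also have "\<dots> = (\<Sum>j\<in>{0, 1}. t ^ j / fact j * d (Suc (m + 2 - j)))"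
        proof (rule sum.mono_neutral_right)
          have "d (Suc (m + 2 - j)) = 0" if "2 \<le> j" for j
            using eq[of "m + 2 - j"] that by (simp add: d_def)
          then show "\<forall>j\<in>{..m + 2} - {0, 1}. t ^ j / fact j * d (Suc (m + 2 - j)) = 0"
            by auto
        qed auto
        finally show ?thesis
          using le[of "b + t"] by (simp add: numeral_3_eq_3)
      qed
      note linear = this
      \<comment> \<open>A linear function that stays nonpositive on \<open>[0, \<infinity>)\<close> has a nonpositive slope.\<close>
      have "d (m + 2) \<le> 0"
      proof (rule ccontr)
        assume "\<not> d (m + 2) \<le> 0"
        then have pos: "0 < d (m + 2)" by simp
        define t where "t = (\<bar>d (m + 3)\<bar> + 1) / d (m + 2)"
        have "0 \<le> t" and "t * d (m + 2) = \<bar>d (m + 3)\<bar> + 1"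
          using pos by (simp_all add: t_def)
        then show False using linear[of t] by simp
      qed
      then show ?thesis by (simp add: d_def 3)
    qed (use le eq' in auto)
  qed
  show ?thesis
    using le le_b eq' by (simp add: mp_sd_interval_def sd_interval_def F_def G_def)
qed

text \<open>For \<open>n - m \<ge> 4\<close> the equality of the first \<open>m\<close> moments leaves room for a quadratic
  expansion at \<open>b\<close>, and a quadratic that is nonnegative on \<open>[0, \<infinity>)\<close> can start with a negative
  slope.\<close>

lemma (in prob_space) mp_sd_real_not_imp_interval:
  assumes rich: "rich_on M a b" and "a < b" and n: "m + 4 \<le> n"
  obtains X Y where "X \<in> rv_on M a b" and "Y \<in> rv_on M a b"
    and "mp_sd_real M n m X Y" and "\<not> mp_sd_interval M a b n m X Y"
proof -
  obtain \<phi> :: "real poly" where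
    zero_a: "\<And>j. j < n \<Longrightarrow> poly ((pderiv ^^ j) \<phi>) a = 0" and
    zero_b: "\<And>j. 3 \<le> j \<Longrightarrow> j < n \<Longrightarrow> poly ((pderiv ^^ j) \<phi>) b = 0" and
    nonneg: "\<And>x. x \<in> {a..b} \<Longrightarrow> 0 \<le> poly \<phi> x" and
    quadratic: "\<And>t. 0 \<le> t \<Longrightarrow>
      0 \<le> poly \<phi> b + t * poly (pderiv \<phi>) b + t\<^sup>2 / 2 * poly (pderiv (pderiv \<phi>)) b" and
    slope: "poly (pderiv \<phi>) b < 0"
    using exists_witness_poly[OF \<open>a < b\<close>, of n] n by auto
  have "poly ((pderiv ^^ (n - 1)) \<phi>) b = 0"
    by (rule zero_b) (use n in auto)
  then obtain X Y \<epsilon> where X: "X \<in> rv_on M a b" and Y: "Y \<in> rv_on M a b" and \<epsilon>: "0 < \<epsilon>"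
    and diff: "\<And>k \<eta>. 1 \<le> k \<Longrightarrow> k < n \<Longrightarrow> \<eta> \<in> {a..b} \<Longrightarrow>
      iter_cdf (Suc k) (dist_fun M X) \<eta>
        = iter_cdf (Suc k) (dist_fun M Y) \<eta> - \<epsilon> * poly ((pderiv ^^ (n - Suc k)) \<phi>) \<eta>"
    using rich_on_obtains_perturbation[OF rich \<open>a < b\<close> _ zero_a, of n] n by auto
  define F where "F k = iter_cdf k (dist_fun M X)" for k
  define G where "G k = iter_cdf k (dist_fun M Y)" for k
  obtain N where N: "n = Suc N" "3 \<le> N"
    using n by (cases n) auto
  have b: "b \<in> {a..b}" using \<open>a < b\<close> by simp
  have diff_b: "F (Suc k) b - G (Suc k) b = - \<epsilon> * poly ((pderiv ^^ (N - k)) \<phi>) b" if "k \<le> N" for k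
  proof (cases "k = 0")
    case True
    then show ?thesis
      using zero_b[of N] N iter_cdf_right_of_support[OF X, of b 0] iter_cdf_right_of_support[OF Y, of b 0]
      by (simp add: F_def G_def del: iter_cdf.simps)
  next
    case False
    then show ?thesis using diff[of k b] that N b by (simp add: F_def G_def del: iter_cdf.simps)
  qed
  have "F n \<eta> \<le> G n \<eta>" for \<eta>
  proof -
    consider "\<eta> < a" | "\<eta> \<in> {a..b}" | "b \<le> \<eta>"
      by fastforce
    then show ?thesis
    proof cases
      case 1
      then show ?thesis
        by (simp add: F_def G_def N iter_cdf_left_of_support[OF X] iter_cdf_left_of_support[OF Y]
            del: iter_cdf.simps)
    next
      case 2
      then show ?thesis
        using diff[of N \<eta>] N nonneg[of \<eta>] \<epsilon> by (simp add: F_def G_def del: iter_cdf.simps)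
    next
      case 3
      define t where "t = \<eta> - b"
      have t: "0 \<le> t" "\<eta> = b + t" using 3 by (simp_all add: t_def)
      have "F n \<eta> - G n \<eta> = (\<Sum>j\<le>N. t ^ j / fact j * (F (Suc (N - j)) b - G (Suc (N - j)) b))"
        by (simp add: F_def G_def t N iter_cdf_Taylor[OF X] iter_cdf_Taylor[OF Y] right_diff_distrib
            sum_subtractf del: iter_cdf.simps)
      also have "\<dots> = (\<Sum>j\<le>N. t ^ j / fact j * (- \<epsilon> * poly ((pderiv ^^ j) \<phi>) b))"
        by (intro sum.cong refl) (simp add: diff_b)
      also have "\<dots> = (\<Sum>j\<in>{0, 1, 2}. t ^ j / fact j * (- \<epsilon> * poly ((pderiv ^^ j) \<phi>) b))"
        by (rule sum.mono_neutral_right) (use N zero_b in auto)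
      also have "\<dots> = - \<epsilon> * (poly \<phi> b + t * poly (pderiv \<phi>) b + t\<^sup>2 / 2 * poly (pderiv (pderiv \<phi>)) b)"
        by (simp add: numeral_2_eq_2 algebra_simps)
      also have "\<dots> \<le> 0"
        using quadratic[OF t(1)] \<epsilon> by simp
      finally show ?thesis by simp
    qed
  qed
  moreover have "F (Suc k) b = G (Suc k) b" if "k \<le> m" for k
    using diff_b[of k] zero_b[of "N - k"] that n N by simp
  ultimately have "mp_sd_real M n m X Y"
    using moments_eq_iff_iter_cdf_eq[OF X Y] by (auto simp: mp_sd_real_def sd_real_def F_def G_def)
  moreover have "\<not> mp_sd_interval M a b n m X Y"
  proof
    assume "mp_sd_interval M a b n m X Y"
    then have "F (Suc (N - 1)) b \<le> G (Suc (N - 1)) b"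
      using N by (simp add: mp_sd_interval_def F_def G_def)
    moreover have "F (Suc (N - 1)) b - G (Suc (N - 1)) b = - \<epsilon> * poly (pderiv \<phi>) b"
      using diff_b[of "N - 1"] N by simp
    moreover have "\<epsilon> * poly (pderiv \<phi>) b < 0"
      using \<epsilon> slope by (simp add: mult_pos_neg)
    ultimately show False by simp
  qed
  ultimately show thesis
    using that X Y by blast
qed

theorem theorem2:
  fixes M :: "'w measure" and a b :: real and m n :: nat
  assumes "prob_space M" and "rich_on M a b"
    and "a < b" and "1 \<le> m" and "1 \<le> n" and "m \<le> n - 1"
  shows "(\<forall>X\<in>rv_on M a b. \<forall>Y\<in>rv_on M a b.
            mp_sd_interval M a b n m X Y \<longrightarrow> mp_sd_real M n m X Y) \<and>
         ((\<forall>X\<in>rv_on M a b. \<forall>Y\<in>rv_on M a b.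
            mp_sd_real M n m X Y \<longrightarrow> mp_sd_interval M a b n m X Y) \<longleftrightarrow> n - m \<le> 3)"
proof -
  interpret prob_space M by fact
  have "m < n" using \<open>1 \<le> n\<close> \<open>m \<le> n - 1\<close> by simp
  have "n - m \<le> 3" if backward: "\<forall>X\<in>rv_on M a b. \<forall>Y\<in>rv_on M a b.
      mp_sd_real M n m X Y \<longrightarrow> mp_sd_interval M a b n m X Y"
  proof (rule ccontr)
    assume "\<not> n - m \<le> 3"
    then have "m + 4 \<le> n" by simp
    from mp_sd_real_not_imp_interval[OF \<open>rich_on M a b\<close> \<open>a < b\<close> this] backward
    show False by blast
  qed
  then show ?thesis
    using mp_sd_interval_imp_real mp_sd_real_imp_interval \<open>1 \<le> n\<close> \<open>m < n\<close> by blast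
qed

end
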